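(* If $\mathcal I$ is an ideal on $\mathbb N$, then $(c_{0,\mathcal I})^{\delta}=\ell_1$ for every $\delta\in\{\alpha,\beta,\gamma\}$.
   Context: $\mathbb K$ is the scalar field. An ideal on $\mathbb N$ is a collection of subsets of $\mathbb N$ containing $\emptyset$, closed under subsets and finite unions; every ideal is assumed to contain all finite sets. $c_{0,\mathcal I}$ is the space of all bounded scalar sequences $(x_n)$ with $\{n:|x_n|\ge\varepsilon\}\in\mathcal I$ for every $\varepsilon>0$. For a space $E$ of scalar sequences, the Köthe–Toeplitz duals are $$E^{\alpha}=\Big\{x\in\mathbb K^{\mathbb N}:\sum_{i=1}^\infty|x_iy_i|<\infty\ \text{for every }y\in E\Big\},$$ $$E^{\beta}=\Big\{x\in\mathbb K^{\mathbb N}:\sum_{i=1}^\infty x_iy_i\ \text{converges for every }y\in E\Big\},$$ $$E^{\gamma}=\Big\{x\in\mathbb K^{\mathbb N}:\sup_{n}\Big|\sum_{i=1}^n x_iy_i\Big|<\infty\ \text{for every }y\in E\Big\}.$$ *)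

theory Defs
  imports Complex_Main
begin

(* Scalars range over the class {real_normed_field, banach}: by Gelfand-Mazur/Ostrowski its
   only models, up to isometric isomorphism, are the reals and the complex numbers, so this is exactly "K = R or C".
   Sequences are indexed by nat, i.e. starting from 0, throughout. *)

(* The improper ideal UNIV is deliberately not excluded. *)
definition ideal_on_nat :: "nat set set \<Rightarrow> bool" where
  "ideal_on_nat \<I> \<longleftrightarrow>
     {} \<in> \<I> \<and>
     (\<forall>A\<in>\<I>. \<forall>B. B \<subseteq> A \<longrightarrow> B \<in> \<I>) \<and>
     (\<forall>A\<in>\<I>. \<forall>B\<in>\<I>. A \<union> B \<in> \<I>) \<and>
     (\<forall>F. finite F \<longrightarrow> F \<in> \<I>)"

definition c0_ideal :: "nat set set \<Rightarrow> (nat \<Rightarrow> 'a::{real_normed_field, banach}) set" where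
  "c0_ideal \<I> = {x. Bseq x \<and> (\<forall>\<epsilon>::real. \<epsilon> > 0 \<longrightarrow> {n. norm (x n) \<ge> \<epsilon>} \<in> \<I>)}"

definition ell1 :: "(nat \<Rightarrow> 'a::{real_normed_field, banach}) set" where
  "ell1 = {x. summable (\<lambda>i. norm (x i))}"

definition alpha_dual ::
  "(nat \<Rightarrow> 'a::{real_normed_field, banach}) set \<Rightarrow> (nat \<Rightarrow> 'a) set" where
  "alpha_dual E = {x. \<forall>y\<in>E. summable (\<lambda>i. norm (x i * y i))}"

definition beta_dual ::
  "(nat \<Rightarrow> 'a::{real_normed_field, banach}) set \<Rightarrow> (nat \<Rightarrow> 'a) set" where
  "beta_dual E = {x. \<forall>y\<in>E. summable (\<lambda>i. x i * y i)}"

definition gamma_dual ::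
  "(nat \<Rightarrow> 'a::{real_normed_field, banach}) set \<Rightarrow> (nat \<Rightarrow> 'a) set" where
  "gamma_dual E = {x. \<forall>y\<in>E. bdd_above (range (\<lambda>n. norm (\<Sum>i<n. x i * y i)))}"

end

theory Submission
  imports Defs
begin

text \<open>
  In the chain \<open>ell1 \<subseteq> alpha \<subseteq> beta \<subseteq> gamma\<close> only the return from the \<open>\<gamma>\<close>-dual to \<open>ell1\<close> has content.
  Every null sequence lies in \<open>c0_ideal \<I>\<close>. If the partial sums \<open>S n\<close> of \<open>\<Sum>i. norm (x i)\<close> are unbounded,
  then \<open>y i = norm (x i) / (x i * sqrt (S i))\<close> is a null sequence, while
  \<open>(\<Sum>i\<le>n. x i * y i) = (\<Sum>i\<le>n. norm (x i) / sqrt (S i)) \<ge> S n / sqrt (S n) = sqrt (S n)\<close> is unbounded.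
\<close>

text \<open>For a null sequence each set in the definition of \<open>c0_ideal\<close> is finite, and
  an ideal contains all finite sets.\<close>

lemma null_seq_in_c0_ideal:
  fixes y :: "nat \<Rightarrow> 'a::{real_normed_field, banach}"
  assumes "ideal_on_nat \<I>" and "y \<longlonglongrightarrow> 0"
  shows "y \<in> c0_ideal \<I>"
proof -
  have "finite {n. norm (y n) \<ge> \<epsilon>}" if \<epsilon>: "\<epsilon> > 0" for \<epsilon> :: real
  proof -
    obtain N where "\<And>n. n \<ge> N \<Longrightarrow> norm (y n) < \<epsilon>"
      using LIMSEQ_D[OF assms(2) \<epsilon>] by auto
    then have "{n. norm (y n) \<ge> \<epsilon>} \<subseteq> {..<N}"
      by (metis (mono_tags, lifting) lessThan_iff mem_Collect_eq not_le subsetI)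
    then show ?thesis
      by (rule finite_subset) simp
  qed
  moreover have "Bseq y"
    using assms(2) by (intro convergent_imp_Bseq convergentI)
  ultimately show ?thesis
    using assms(1) by (auto simp: c0_ideal_def ideal_on_nat_def)
qed

text \<open>A nonnegative series with bounded partial sums is summable, so some partial sum exceeds
  \<open>Z\<close>; by monotonicity all later ones do too.\<close>

lemma not_summable_imp_partial_sums_at_top:
  fixes a :: "nat \<Rightarrow> real"
  assumes "\<And>i. a i \<ge> 0" and "\<not> summable a"
  shows "filterlim (\<lambda>n. \<Sum>i\<le>n. a i) at_top sequentially"
  unfolding filterlim_at_top eventually_sequentially
proof
  fix Z :: real
  obtain N where N: "(\<Sum>i\<le>N. a i) > Z"
    using bounded_imp_summable[of a Z] assms by (meson not_le)
  have "Z \<le> (\<Sum>i\<le>n. a i)" if "n \<ge> N" for n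
    using N sum_mono2[of "{..n}" "{..N}" a] that assms(1) by force
  then show "\<exists>N. \<forall>n\<ge>N. Z \<le> (\<Sum>i\<le>n. a i)"
    by blast
qed

lemma gamma_dual_c0_ideal_subset_ell1:
  assumes "ideal_on_nat \<I>"
  shows "gamma_dual (c0_ideal \<I>) \<subseteq> (ell1 :: (nat \<Rightarrow> 'a::{real_normed_field, banach}) set)"
proof
  fix x :: "nat \<Rightarrow> 'a"
  assume x: "x \<in> gamma_dual (c0_ideal \<I>)"
  show "x \<in> ell1"
  proof (rule ccontr)
    assume "x \<notin> ell1"
    define S where "S n = (\<Sum>i\<le>n. norm (x i))" for n
    have "filterlim S at_top sequentially"
      unfolding S_def using \<open>x \<notin> ell1\<close>
      by (intro not_summable_imp_partial_sums_at_top) (auto simp: ell1_def)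
    then have sqrt_S: "filterlim (\<lambda>n. sqrt (S n)) at_top sequentially"
      by (rule filterlim_compose[OF sqrt_at_top])
    have S_nonneg: "S n \<ge> 0" for n
      unfolding S_def by (intro sum_nonneg) simp
    have S_mono: "S i \<le> S n" if "i \<le> n" for i n
      unfolding S_def using that by (intro sum_mono2) auto
    \<comment> \<open>Since division by 0 yields 0, \<open>y i = 0\<close> whenever
      \<open>x i = 0\<close>; this covers every \<open>i\<close> with \<open>S i = 0\<close>. The
      factor \<open>norm (x i) / x i\<close> makes each \<open>x i * y i\<close> a nonnegative real
      embedded in the field.\<close>
    define y where "y i = of_real (norm (x i) / sqrt (S i)) / x i" for i
    have "y \<longlonglongrightarrow> 0"
    proof (rule tendsto_0_le[where K = 1])
      show "(\<lambda>n. inverse (sqrt (S n))) \<longlonglongrightarrow> 0"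
        using sqrt_S by (rule tendsto_inverse_0_at_top)
      \<comment> \<open>Equality holds when \<open>x n\<close> is nonzero; otherwise the left side
        is 0.\<close>
      show "\<forall>\<^sub>F n in sequentially. norm (y n) \<le> norm (inverse (sqrt (S n))) * 1"
        by (intro always_eventually allI) (simp add: y_def norm_divide abs_divide inverse_eq_divide del: of_real_divide)
    qed
    then have "y \<in> c0_ideal \<I>"
      by (rule null_seq_in_c0_ideal[OF assms])
    then have "bdd_above (range (\<lambda>n. norm (\<Sum>i<n. x i * y i)))"
      using x by (simp add: gamma_dual_def)
    then obtain B where B: "\<And>n. norm (\<Sum>i<n. x i * y i) \<le> B"
      by (auto simp: bdd_above_def)
    have "sqrt (S n) \<le> B" for n
    proof -
      have "sqrt (S n) = (\<Sum>i\<le>n. norm (x i) / sqrt (S n))"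
        using S_nonneg[of n] by (simp add: S_def real_div_sqrt flip: sum_divide_distrib)
      also have "\<dots> \<le> (\<Sum>i\<le>n. norm (x i) / sqrt (S i))"
      proof (rule sum_mono)
        fix i assume "i \<in> {..n}"
        show "norm (x i) / sqrt (S n) \<le> norm (x i) / sqrt (S i)"
        \<comment> \<open>Enlarging the denominator from \<open>sqrt (S i)\<close> to
          \<open>sqrt (S n)\<close> requires \<open>S i > 0\<close>, which a nonzero
          \<open>x i\<close> guarantees. If \<open>x i = 0\<close>, both sides vanish.\<close>
        proof (cases "x i = 0")
          case False
          have "norm (x i) \<le> S i"
            unfolding S_def by (intro member_le_sum) auto
          with False have "S i > 0"
            by (smt (verit) zero_less_norm_iff)
          moreover have "S i \<le> S n"
            using S_mono \<open>i \<in> {..n}\<close> by simp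
          ultimately show ?thesis
            by (intro divide_left_mono) auto
        qed simp
      qed
      also have "\<dots> \<le> norm (of_real (\<Sum>i\<le>n. norm (x i) / sqrt (S i)) :: 'a)"
        unfolding norm_of_real by (rule abs_ge_self)
      \<comment> \<open>The sum \<open>S n\<close> includes index \<open>n\<close>, while the
        \<gamma>-dual sums over \<open>i < n\<close>; hence the bound \<open>B\<close> is used at
        \<open>Suc n\<close>.\<close>
      also have "of_real (\<Sum>i\<le>n. norm (x i) / sqrt (S i)) = (\<Sum>i<Suc n. x i * y i)"
        unfolding of_real_sum lessThan_Suc_atMost by (intro sum.cong) (auto simp: y_def)
      also have "norm \<dots> \<le> B"
        by (rule B)
      finally show ?thesis .
    qed
    then show False
      using sqrt_S unfolding filterlim_at_top_dense eventually_sequentially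
      by (metis not_le order_refl)
  qed
qed

text \<open>Members of \<open>c0_ideal \<I>\<close> are bounded, so a bound \<open>K\<close> for
  \<open>y\<close> gives the summable majorant \<open>norm (x i) * K\<close>.\<close>

lemma ell1_subset_alpha_dual_c0_ideal:
  "ell1 \<subseteq> alpha_dual (c0_ideal \<I>)"
proof -
  have "summable (\<lambda>i. norm (x i * y i))"
    if x: "summable (\<lambda>i. norm (x i))" and y: "Bseq y" for x y :: "nat \<Rightarrow> 'a"
  proof -
    obtain K where "\<And>i. norm (y i) \<le> K"
      using BseqE[OF y] by blast
    then have "norm (x i * y i) \<le> norm (x i) * K" for i
      by (simp add: norm_mult mult_left_mono)
    then show ?thesis
      by (intro summable_comparison_test'[OF summable_mult2[OF x]]) simp
  qed
  then show ?thesis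
    by (auto simp: ell1_def alpha_dual_def c0_ideal_def)
qed

text \<open>Completeness of the scalar field enters here: absolute convergence implies
  convergence.\<close>

lemma alpha_dual_subset_beta_dual: "alpha_dual E \<subseteq> beta_dual E"
  by (auto simp: alpha_dual_def beta_dual_def intro: summable_norm_cancel)

lemma beta_dual_subset_gamma_dual: "beta_dual E \<subseteq> gamma_dual E"
proof -
  have "bdd_above (range (\<lambda>n. norm (\<Sum>i<n. z i)))" if "summable z" for z :: "nat \<Rightarrow> 'a"
    using that by (auto simp: summable_iff_convergent bdd_above_def
        dest!: convergent_imp_Bseq elim!: BseqE)
  then show ?thesis
    by (auto simp: beta_dual_def gamma_dual_def)
qed

theorem corollary3p7:
  fixes \<I> :: "nat set set"
    and \<delta> :: "(nat \<Rightarrow> 'a::{real_normed_field, banach}) set \<Rightarrow> (nat \<Rightarrow> 'a) set"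
  assumes "ideal_on_nat \<I>"
    and "\<delta> \<in> {alpha_dual, beta_dual, gamma_dual}"
  shows "\<delta> (c0_ideal \<I>) = ell1"
  using assms(2) gamma_dual_c0_ideal_subset_ell1[OF assms(1), where 'a = 'a]
    ell1_subset_alpha_dual_c0_ideal[of \<I>, where 'a = 'a]
    alpha_dual_subset_beta_dual[of "c0_ideal \<I> :: (nat \<Rightarrow> 'a) set"]
    beta_dual_subset_gamma_dual[of "c0_ideal \<I> :: (nat \<Rightarrow> 'a) set"]
  by auto

end
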